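(* Let $P, Q : (E,R)\,\mathsf{itree}$. Then: (1) if $(s,X)\in\mathsf{failures}(P)$ and $Y \cap \{x \in \Sigma^{\checkmark} \mid s\frown[x]\in\mathsf{traces}(P)\} = \emptyset$ then $(s, X\cup Y)\in\mathsf{failures}(P)$; (2) if $s\in\mathsf{divergences}(P)$ and $t$ is a finite list with all elements in $E$, then $s\frown t\in\mathsf{divergences}(P)$; (3) if $P\approx Q$ then $\mathsf{failures}(P)=\mathsf{failures}(Q)$ and $\mathsf{divergences}(P)=\mathsf{divergences}(Q)$; (4) $P\in\mathsf{divfree}$ iff $\mathsf{divergences}(P)=\emptyset$; (5) if $P\in\mathsf{divfree}$ then for all $s$ and $a$, if $s\frown[a]\in\mathsf{traces}(P)$ then $(s,\{a\})\notin\mathsf{failures}(P)$.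
   Context: For a set $E$ of events and a set $R$ of return values, $(E,R)\,\mathsf{itree}$ is the coinductive datatype (possibly infinite trees) with constructors $\mathsf{Ret}\,r$ ($r\in R$), $\mathsf{Sil}\,P$ (written $\tau P$), and $\mathsf{Vis}\,F$ with $F: E\rightharpoonup (E,R)\,\mathsf{itree}$ a partial function. $\tau^n P$ is $n$-fold $\mathsf{Sil}$; $\mathsf{stop}=\mathsf{Vis}$ of the empty partial function. $P$ is stable if it is not of the form $\mathsf{Sil}\,P'$; $P$ stabilises if $P=\tau^n P'$ for some $n\in\mathbb{N}$ and stable $P'$; $P$ is divergent if it does not stabilise. Big-step transitions $P\xrightarrow{tr}P'$ ($tr$ a finite list over $E$): least relation with $P\xrightarrow{[]}P$; $P\xrightarrow{tr}P'$ implies $\mathsf{Sil}\,P\xrightarrow{tr}P'$; $e\in\mathrm{dom}(F)$ and $F(e)\xrightarrow{tr}P'$ imply $\mathsf{Vis}\,F\xrightarrow{e\# tr}P'$. Let $\Sigma=E$ and $\Sigma^{\checkmark}=E\cup\{\checkmark_x\mid x\in R\}$ (disjoint union, $\checkmark_x$ fresh termination events). For a list $s$, $\mathrm{set}(s)$ is its set of elements; $\frown$ is concatenation. Step relation: $P\xRightarrow{s}P'$ iff either ($s=t\frown[\checkmark_x]$ for some list $t$ over $E$ and some $x$ with $P\xrightarrow{t}\mathsf{Ret}\,x$ and $P'=\mathsf{stop}$) or ($\mathrm{set}(s)\subseteq E$ and $P\xrightarrow{s}P'$). $\mathsf{traces}(P)=\{s\mid \mathrm{set}(s)\subseteq\Sigma^{\checkmark}\wedge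 \exists P'.\,P\xRightarrow{s}P'\}$. For $X\subseteq\Sigma^{\checkmark}$, $P\ \mathsf{ref}\ X$ iff ($P=\mathsf{Vis}\,F$ with $X\cap\mathrm{dom}(F)=\emptyset$) or ($P=\mathsf{Ret}\,x$ with $\checkmark_x\notin X$). $\mathsf{failures}(P)=\{(s,X)\mid \mathrm{set}(s)\subseteq\Sigma^{\checkmark}\wedge\exists Q.\,P\xRightarrow{s}Q\wedge Q\ \mathsf{ref}\ X\}$. $\mathsf{divergences}(P)=\{s\frown t\mid \mathrm{set}(s)\subseteq E\wedge\mathrm{set}(t)\subseteq E\wedge\exists Q.\,P\xRightarrow{s}Q\wedge Q \text{ divergent}\}$. Divergence freedom: for a set $\mathcal{R}$ of itrees, $P\trianglerighteq\mathcal{R}$ is defined inductively by $\mathsf{Ret}\,x\trianglerighteq\mathcal{R}$; $P\trianglerighteq\mathcal{R}$ implies $\mathsf{Sil}\,P\trianglerighteq\mathcal{R}$; $\mathrm{ran}(F)\subseteq\mathcal{R}$ implies $\mathsf{Vis}\,F\trianglerighteq\mathcal{R}$. $\mathsf{divfree}=\bigcup\{\mathcal{R}\mid \mathcal{R}\subseteq\{P\mid P\trianglerighteq\mathcal{R}\}\}$. Weak bisimilarity $\approx$ is the greatest relation $\mathcal{W}$ such that whenever $(P,Q)\in\mathcal{W}$, either $P=\mathsf{Sil}\,P'$, $Q=\mathsf{Sil}\,Q'$ with $(P',Q')\in\mathcal{W}$, or $P=\tau^m P'$, $Q=\tau^n Q'$ with $P',Q'$ stable and either $P'=Q'=\mathsf{Ret}\,x$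 for some $x$, or $P'=\mathsf{Vis}\,F$, $Q'=\mathsf{Vis}\,G$ with $\mathrm{dom}(F)=\mathrm{dom}(G)$ and $(F(e),G(e))\in\mathcal{W}$ for all $e\in\mathrm{dom}(F)$. *)

theory Defs
  imports Main
begin

text \<open>The event set and the return set are the type parameters, so
  side conditions saying that something consists of events in
  \<open>E\<close> or \<open>\<Sigma>\<^sup>\<checkmark>\<close> are carried by the types wherever possible.\<close>

codatatype ('e, 'r) itree =
    Ret 'r
  | Sil "('e, 'r) itree"
  | Vis "'e \<rightharpoonup> ('e, 'r) itree"

abbreviation Sils :: "nat \<Rightarrow> ('e, 'r) itree \<Rightarrow> ('e, 'r) itree" where
  "Sils n P \<equiv> (Sil ^^ n) P"

definition stop :: "('e, 'r) itree" where
  "stop = Vis Map.empty"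

definition stable :: "('e, 'r) itree \<Rightarrow> bool" where
  "stable P \<longleftrightarrow> (\<nexists>P'. P = Sil P')"

definition stabilises :: "('e, 'r) itree \<Rightarrow> bool" where
  "stabilises P \<longleftrightarrow> (\<exists>n P'. stable P' \<and> P = Sils n P')"

definition divergent :: "('e, 'r) itree \<Rightarrow> bool" where
  "divergent P \<longleftrightarrow> \<not> stabilises P"

inductive trace_to :: "('e, 'r) itree \<Rightarrow> 'e list \<Rightarrow> ('e, 'r) itree \<Rightarrow> bool" where
  trace_to_Nil: "trace_to P [] P"
| trace_to_Sil: "trace_to P tr P' \<Longrightarrow> trace_to (Sil P) tr P'"
| trace_to_Vis: "e \<in> dom F \<Longrightarrow> trace_to (the (F e)) tr P' \<Longrightarrow> trace_to (Vis F) (e # tr) P'"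

text \<open>The type of \<open>\<Sigma>\<^sup>\<checkmark>\<close>; the subset \<open>\<Sigma>\<close> is \<open>range Ev\<close>,
  and lists over \<open>\<Sigma>\<close> are exactly those of the form \<open>map Ev t\<close>.\<close>

datatype ('e, 'r) tick_event = Ev 'e | Tick 'r

definition step_to :: "('e, 'r) itree \<Rightarrow> ('e, 'r) tick_event list \<Rightarrow> ('e, 'r) itree \<Rightarrow> bool" where
  "step_to P s P' \<longleftrightarrow>
     (\<exists>t x. s = map Ev t @ [Tick x] \<and> trace_to P t (Ret x) \<and> P' = stop) \<or>
     (\<exists>t. s = map Ev t \<and> trace_to P t P')"

definition traces :: "('e, 'r) itree \<Rightarrow> ('e, 'r) tick_event list set" where
  "traces P = {s. \<exists>P'. step_to P s P'}"

definition refuses :: "('e, 'r) itree \<Rightarrow> ('e, 'r) tick_event set \<Rightarrow> bool" where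
  "refuses P X \<longleftrightarrow>
     (\<exists>F. P = Vis F \<and> X \<inter> Ev ` dom F = {}) \<or> (\<exists>x. P = Ret x \<and> Tick x \<notin> X)"

definition failures ::
  "('e, 'r) itree \<Rightarrow> (('e, 'r) tick_event list \<times> ('e, 'r) tick_event set) set" where
  "failures P = {(s, X). \<exists>Q. step_to P s Q \<and> refuses Q X}"

definition divergences :: "('e, 'r) itree \<Rightarrow> ('e, 'r) tick_event list set" where
  "divergences P =
     {s @ t | s t. set s \<subseteq> range Ev \<and> set t \<subseteq> range Ev \<and> (\<exists>Q. step_to P s Q \<and> divergent Q)}"

inductive div_free_to :: "('e, 'r) itree set \<Rightarrow> ('e, 'r) itree \<Rightarrow> bool"
  for \<R> :: "('e, 'r) itree set" where
  div_free_to_Ret: "div_free_to \<R> (Ret x)"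
| div_free_to_Sil: "div_free_to \<R> P \<Longrightarrow> div_free_to \<R> (Sil P)"
| div_free_to_Vis: "ran F \<subseteq> \<R> \<Longrightarrow> div_free_to \<R> (Vis F)"

definition divfree :: "('e, 'r) itree set" where
  "divfree = \<Union> {\<R>. \<R> \<subseteq> {P. div_free_to \<R> P}}"

coinductive weak_bisim :: "('e, 'r) itree \<Rightarrow> ('e, 'r) itree \<Rightarrow> bool" where
  weak_bisim_Sil: "weak_bisim P Q \<Longrightarrow> weak_bisim (Sil P) (Sil Q)"
| weak_bisim_Ret: "weak_bisim (Sils m (Ret x)) (Sils n (Ret x))"
| weak_bisim_Vis: "dom F = dom G \<Longrightarrow> \<forall>e\<in>dom F. weak_bisim (the (F e)) (the (G e)) \<Longrightarrow>
    weak_bisim (Sils m (Vis F)) (Sils n (Vis G))"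

end

theory Submission
  imports Defs
begin

text \<open>Itrees are deterministic: whichever tree \<open>P\<close> has become after a trace \<open>s\<close>, it can continue
  exactly with those \<open>t\<close> for which \<open>s @ t\<close> is a trace of \<open>P\<close>. So a stable tree reached by \<open>s\<close>
  refuses precisely the sets disjoint from the one-event extensions of \<open>s\<close>, and the failures of \<open>P\<close>
  are determined by its traces together with the set of traces after which it stabilises. This
  gives (1) and (5), and it reduces (3) to the invariance of big steps and of stabilisation under
  weak bisimilarity. For (4), the trees without divergences are closed under transitions and
  stabilise, hence form a post-fixed point of the operator whose greatest fixed point is
  \<^const>\<open>divfree\<close>.\<close>

lemma stable_Ret [simp]: "stable (Ret x)"
  and stable_Vis [simp]: "stable (Vis F)"
  and not_stable_Sil [simp]: "\<not> stable (Sil P)"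
  by (auto simp: stable_def)

lemma stableE:
  assumes "stable P"
  obtains (Ret) x where "P = Ret x" | (Vis) F where "P = Vis F"
  using assms by (cases P) auto

lemma Ret_eq_Sils_iff [simp]: "Ret x = Sils n P \<longleftrightarrow> n = 0 \<and> P = Ret x"
  and Vis_eq_Sils_iff [simp]: "Vis F = Sils n P \<longleftrightarrow> n = 0 \<and> P = Vis F"
  by (cases n; auto)+

subsection \<open>Big-step transitions\<close>

lemma trace_to_Ret_iff [simp]: "trace_to (Ret x) s Q \<longleftrightarrow> s = [] \<and> Q = Ret x"
  by (subst trace_to.simps) auto

lemma trace_to_Sil_iff [simp]: "trace_to (Sil P) s Q \<longleftrightarrow> s = [] \<and> Q = Sil P \<or> trace_to P s Q"
  by (subst trace_to.simps) auto

lemma trace_to_Vis_iff: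
  "trace_to (Vis F) s Q \<longleftrightarrow>
     s = [] \<and> Q = Vis F \<or> (\<exists>e t P. s = e # t \<and> F e = Some P \<and> trace_to P t Q)"
  by (subst trace_to.simps) force

lemma trace_to_append: "trace_to P s Q \<Longrightarrow> trace_to Q t Q' \<Longrightarrow> trace_to P (s @ t) Q'"
  by (induction rule: trace_to.induct) (auto intro: trace_to.intros)

lemma trace_to_Nil_iff: "trace_to P [] Q \<longleftrightarrow> (\<exists>n. P = Sils n Q)"
proof
  assume "trace_to P [] Q"
  then show "\<exists>n. P = Sils n Q"
  proof (induction P "[] :: 'a list" Q rule: trace_to.induct)
    case (trace_to_Nil P)
    then show ?case by (metis funpow_0)
  next
    case (trace_to_Sil P P')
    then show ?case by (metis comp_apply funpow.simps(2))
  qed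
next
  assume "\<exists>n. P = Sils n Q"
  then obtain n where "P = Sils n Q" ..
  then show "trace_to P [] Q"
    by (induction n arbitrary: P) (auto intro: trace_to_Nil)
qed

lemma trace_to_deterministic:
  assumes "trace_to P s Q" "trace_to P (s @ t) Q'"
  shows "trace_to Q t Q' \<or> t = [] \<and> trace_to Q' [] Q"
  using assms
proof (induction rule: trace_to.induct)
  case (trace_to_Sil P s Q)
  from trace_to_Sil.prems consider (Sil) "trace_to P (s @ t) Q'" | (Nil) "s @ t = []" "Q' = Sil P"
    by auto
  then show ?case
  proof cases
    case Sil
    then show ?thesis by (rule trace_to_Sil.IH)
  next
    case Nil
    then show ?thesis using trace_to_Sil.hyps by simp
  qed
next
  case (trace_to_Vis e F s Q)
  from trace_to_Vis.prems have "trace_to (the (F e)) (s @ t) Q'"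
    by (auto simp: trace_to_Vis_iff)
  then show ?case by (rule trace_to_Vis.IH)
qed simp

lemma stabilises_iff_trace_to: "stabilises P \<longleftrightarrow> (\<exists>Q. trace_to P [] Q \<and> stable Q)"
  by (auto simp: stabilises_def trace_to_Nil_iff)

lemma stable_imp_stabilises: "stable P \<Longrightarrow> stabilises P"
  by (auto simp: stabilises_iff_trace_to intro: trace_to_Nil)

lemma stabilises_Ret [simp]: "stabilises (Ret x)"
  and stabilises_Vis [simp]: "stabilises (Vis F)"
  by (simp_all add: stable_imp_stabilises)

lemma stabilises_Sil [simp]: "stabilises (Sil P) \<longleftrightarrow> stabilises P"
  by (auto simp: stabilises_iff_trace_to)

lemma stabilises_Sils [simp]: "stabilises (Sils n P) \<longleftrightarrow> stabilises P"
  by (induction n) simp_all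

lemma map_Ev_neq_append_Tick [simp]: "map Ev t \<noteq> u @ Tick x # v" "u @ Tick x # v \<noteq> map Ev t"
  by (auto simp: map_eq_append_conv append_eq_map_conv)

lemma map_Ev_append_Tick_eq_iff [simp]:
  "map Ev u @ Tick y # v = map Ev t @ [Tick x] \<longleftrightarrow> u = t \<and> y = x \<and> v = []"
  by (induction u t rule: list_induct2') (auto simp: Cons_eq_append_conv)

lemma map_Ev_eq_iff [simp]: "map Ev t = map Ev u \<longleftrightarrow> t = u"
  by (simp add: inj_map_eq_map inj_def)

lemma subset_range_Ev_iff: "set s \<subseteq> range Ev \<longleftrightarrow> (\<exists>t. s = map Ev t)"
  by (auto simp: ex_map_conv image_iff subset_iff)

lemma tick_event_list_cases [case_names Ev Tick]:
  obtains t where "s = map Ev t" | t x u where "s = map Ev t @ Tick x # u"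
proof (induction s arbitrary: thesis)
  case Nil
  then show ?case by simp
next
  case (Cons a s)
  show ?case
  proof (cases a)
    case (Ev e)
    then show ?thesis by (metis Cons append_Cons list.map(2))
  next
    case (Tick x)
    then show ?thesis by (metis Cons.prems(2) append_Nil list.map(1))
  qed
qed

lemma step_to_Ev [simp]: "step_to P (map Ev t) Q \<longleftrightarrow> trace_to P t Q"
  by (auto simp: step_to_def)

lemma step_to_Tick [simp]:
  "step_to P (map Ev t @ Tick x # u) Q \<longleftrightarrow> u = [] \<and> trace_to P t (Ret x) \<and> Q = stop"
  by (auto simp: step_to_def)

lemma step_to_Ev_append [simp]:
  "step_to P (map Ev t @ map Ev u) Q \<longleftrightarrow> trace_to P (t @ u) Q"
  using step_to_Ev[of P "t @ u"] by simp

lemma step_to_Ev_append_Tick [simp]: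
  "step_to P (map Ev t @ map Ev u @ Tick x # v) Q \<longleftrightarrow>
     v = [] \<and> trace_to P (t @ u) (Ret x) \<and> Q = stop"
  using step_to_Tick[of P "t @ u"] by simp

lemma step_to_Nil_iff [simp]: "step_to P [] Q \<longleftrightarrow> trace_to P [] Q"
  using step_to_Ev[of P "[]"] by simp

lemma step_to_stop_iff [simp]: "step_to stop s Q \<longleftrightarrow> s = [] \<and> Q = stop"
  by (cases s rule: tick_event_list_cases) (auto simp: stop_def trace_to_Vis_iff)

lemma step_toE:
  assumes "step_to P s Q"
  obtains (Ev) t where "s = map Ev t" "trace_to P t Q"
  | (Tick) t x where "s = map Ev t @ [Tick x]" "trace_to P t (Ret x)" "Q = stop"
  using assms unfolding step_to_def by blast

lemma step_to_append:
  assumes "step_to P s Q" "step_to Q t Q'"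
  shows "step_to P (s @ t) Q'"
  using assms(1)
proof (cases rule: step_toE)
  case (Ev u)
  with assms(2) show ?thesis
    by (cases t rule: tick_event_list_cases) (auto intro: trace_to_append)
next
  case (Tick u x)
  with assms show ?thesis by simp
qed

lemma step_to_deterministic:
  assumes "step_to P s Q" "step_to P (s @ t) Q'"
  shows "step_to Q t Q' \<or> t = [] \<and> step_to Q' [] Q"
  using assms(1)
proof (cases rule: step_toE)
  case (Ev u)
  with assms(2) show ?thesis
    by (cases t rule: tick_event_list_cases) (auto dest: trace_to_deterministic intro: trace_to_Nil)
next
  case (Tick u x)
  with assms(2) show ?thesis by (simp add: trace_to_Nil)
qed

lemma step_to_imp_traces: "step_to P s Q \<Longrightarrow> s \<in> traces P"
  by (auto simp: traces_def)

lemma Nil_in_traces [simp]: "[] \<in> traces P"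
  by (rule step_to_imp_traces[of P "[]" P]) (simp add: trace_to_Nil)

lemma traces_append_iff:
  assumes "step_to P s Q"
  shows "s @ t \<in> traces P \<longleftrightarrow> t \<in> traces Q"
proof
  assume "s @ t \<in> traces P"
  then obtain Q' where "step_to P (s @ t) Q'" by (auto simp: traces_def)
  from step_to_deterministic[OF assms this] show "t \<in> traces Q"
    by (auto intro: step_to_imp_traces)
next
  assume "t \<in> traces Q"
  then show "s @ t \<in> traces P"
    using step_to_append[OF assms] by (auto simp: traces_def)
qed

subsection \<open>Refusals and failures\<close>

definition initials :: "('e, 'r) itree \<Rightarrow> ('e, 'r) tick_event set" where
  "initials P = {a. [a] \<in> traces P}"

lemma Ev_in_initials_iff: "Ev e \<in> initials P \<longleftrightarrow> (\<exists>Q. trace_to P [e] Q)"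
  using step_to_Ev[of P "[e]"] by (auto simp: initials_def traces_def)

lemma Tick_in_initials_iff: "Tick x \<in> initials P \<longleftrightarrow> trace_to P [] (Ret x)"
  using step_to_Tick[of P "[]" x "[]"] by (auto simp: initials_def traces_def)

lemma initials_Ret [simp]: "initials (Ret x) = {Tick x}"
proof (rule set_eqI)
  show "a \<in> initials (Ret x) \<longleftrightarrow> a \<in> {Tick x}" for a
    by (cases a) (auto simp: Ev_in_initials_iff Tick_in_initials_iff)
qed

lemma initials_Vis [simp]: "initials (Vis F) = Ev ` dom F"
proof (rule set_eqI)
  show "a \<in> initials (Vis F) \<longleftrightarrow> a \<in> Ev ` dom F" for a
    by (cases a)
      (auto simp: Ev_in_initials_iff Tick_in_initials_iff trace_to_Vis_iff intro: trace_to_Nil)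
qed

lemma refuses_iff: "refuses P X \<longleftrightarrow> stable P \<and> X \<inter> initials P = {}"
  by (cases P) (auto simp: refuses_def)

lemma failures_iff:
  "(s, X) \<in> failures P \<longleftrightarrow>
     (\<exists>Q. step_to P s Q \<and> stabilises Q) \<and> X \<inter> {a. s @ [a] \<in> traces P} = {}"
proof -
  have "(s, X) \<in> failures P \<longleftrightarrow> (\<exists>Q. step_to P s Q \<and> stable Q \<and> X \<inter> initials Q = {})"
    by (simp add: failures_def refuses_iff)
  also have "\<dots> \<longleftrightarrow> (\<exists>Q. step_to P s Q \<and> stable Q) \<and> X \<inter> {a. s @ [a] \<in> traces P} = {}"
    by (auto simp: traces_append_iff initials_def)
  also have "(\<exists>Q. step_to P s Q \<and> stable Q) \<longleftrightarrow> (\<exists>Q. step_to P s Q \<and> stabilises Q)"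
  proof
    assume "\<exists>Q. step_to P s Q \<and> stabilises Q"
    then obtain Q Q' where "step_to P s Q" "step_to Q [] Q'" "stable Q'"
      by (auto simp: stabilises_iff_trace_to)
    then show "\<exists>Q. step_to P s Q \<and> stable Q"
      using step_to_append by fastforce
  qed (auto intro: stable_imp_stabilises)
  finally show ?thesis .
qed

subsection \<open>Divergences\<close>

lemma divergences_append:
  assumes "s \<in> divergences P" "set t \<subseteq> range Ev"
  shows "s @ t \<in> divergences P"
proof -
  from assms(1) obtain u v Q where "s = u @ v" "set u \<subseteq> range Ev" "set v \<subseteq> range Ev"
    "step_to P u Q" "divergent Q"
    by (auto simp: divergences_def)
  moreover have "set (v @ t) \<subseteq> range Ev"
    using \<open>set v \<subseteq> range Ev\<close> assms(2) by simp
  ultimately show ?thesis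
    unfolding divergences_def by fastforce
qed

lemma divergences_empty_iff:
  "divergences P = {} \<longleftrightarrow> (\<forall>s Q. trace_to P s Q \<longrightarrow> stabilises Q)"
proof -
  have "divergences P = {} \<longleftrightarrow> (\<forall>s Q. set s \<subseteq> range Ev \<and> step_to P s Q \<longrightarrow> stabilises Q)"
    unfolding divergences_def divergent_def by (auto intro: exI[of _ "[]"])
  also have "\<dots> \<longleftrightarrow> (\<forall>s Q. step_to P (map Ev s) Q \<longrightarrow> stabilises Q)"
    unfolding subset_range_Ev_iff by blast
  finally show ?thesis by simp
qed

lemma divergences_empty_trace_to:
  "divergences P = {} \<Longrightarrow> trace_to P s Q \<Longrightarrow> divergences Q = {}"
  unfolding divergences_empty_iff by (blast intro: trace_to_append)

lemma div_free_to_mono: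
  assumes "div_free_to \<R> P" "\<R> \<subseteq> \<S>"
  shows "div_free_to \<S> P"
  using assms by (induction rule: div_free_to.induct) (auto intro: div_free_to.intros)

lemma div_free_to_Sils: "div_free_to \<R> P \<Longrightarrow> div_free_to \<R> (Sils n P)"
  by (induction n) (auto intro: div_free_to_Sil)

lemma div_free_to_imp_stabilises: "div_free_to \<R> P \<Longrightarrow> stabilises P"
  by (induction rule: div_free_to.induct) simp_all

lemma mono_div_free_to: "mono (\<lambda>\<R>. {P. div_free_to \<R> P})"
  by (auto intro!: monoI elim: div_free_to_mono)

lemma divfree_eq_gfp: "divfree = gfp (\<lambda>\<R>. {P. div_free_to \<R> P})"
  by (simp add: divfree_def gfp_def)

lemma divfree_iff_div_free_to: "P \<in> divfree \<longleftrightarrow> div_free_to divfree P"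
  using gfp_unfold[OF mono_div_free_to] unfolding divfree_eq_gfp by blast

lemma divfree_SilD: "Sil P \<in> divfree \<Longrightarrow> P \<in> divfree"
  by (subst (asm) divfree_iff_div_free_to, subst divfree_iff_div_free_to)
    (auto elim: div_free_to.cases)

lemma divfree_VisD: "Vis F \<in> divfree \<Longrightarrow> F e = Some P \<Longrightarrow> P \<in> divfree"
  by (subst (asm) divfree_iff_div_free_to) (auto elim!: div_free_to.cases intro: ranI)

lemma divfree_trace_to: "trace_to P s Q \<Longrightarrow> P \<in> divfree \<Longrightarrow> Q \<in> divfree"
  by (induction rule: trace_to.induct) (auto dest: divfree_SilD divfree_VisD)

lemma divergences_empty_VisD:
  assumes "divergences (Vis F) = {}" "F e = Some Q"
  shows "divergences Q = {}"
proof (rule divergences_empty_trace_to)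
  show "trace_to (Vis F) [e] Q"
    using assms(2) by (auto simp: trace_to_Vis_iff intro: trace_to_Nil)
qed (fact assms(1))

lemma divergences_empty_imp_div_free_to:
  assumes "divergences P = {}"
  shows "div_free_to {P. divergences P = {}} P"
proof -
  have "stabilises P"
    using assms trace_to_Nil by (auto simp: divergences_empty_iff)
  then obtain n P' where P': "stable P'" "P = Sils n P'"
    by (auto simp: stabilises_def)
  then have "trace_to P [] P'"
    by (auto simp: trace_to_Nil_iff)
  with assms have "divergences P' = {}"
    by (rule divergences_empty_trace_to)
  from P'(1) have "div_free_to {P. divergences P = {}} P'"
  proof (cases rule: stableE)
    case (Ret x)
    then show ?thesis by (simp add: div_free_to_Ret)
  next
    case (Vis F)
    with \<open>divergences P' = {}\<close> have "ran F \<subseteq> {P. divergences P = {}}"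
      by (auto simp: ran_def dest: divergences_empty_VisD)
    then show ?thesis unfolding Vis by (rule div_free_to_Vis)
  qed
  then show ?thesis using P'(2) by (simp add: div_free_to_Sils)
qed

lemma divfree_iff_divergences_empty: "P \<in> divfree \<longleftrightarrow> divergences P = {}"
proof
  assume "P \<in> divfree"
  then have "stabilises Q" if "trace_to P s Q" for s Q
    using divfree_trace_to[OF that] divfree_iff_div_free_to div_free_to_imp_stabilises by blast
  then show "divergences P = {}"
    by (simp add: divergences_empty_iff)
next
  have "{P. divergences P = {}} \<subseteq> divfree"
    unfolding divfree_eq_gfp by (rule gfp_upperbound) (auto intro: divergences_empty_imp_div_free_to)
  moreover assume "divergences P = {}"
  ultimately show "P \<in> divfree" by blast
qed

subsection \<open>Weak bisimilarity\<close>

lemma weak_bisim_refl: "weak_bisim P P"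
proof (coinduction arbitrary: P)
  case weak_bisim
  show ?case by (cases P) auto
qed

lemma weak_bisim_sym: "weak_bisim P Q \<Longrightarrow> weak_bisim Q P"
proof (coinduction arbitrary: P Q)
  case weak_bisim
  then show ?case
  proof (cases rule: weak_bisim.cases)
    case weak_bisim_Sil
    then show ?thesis by auto
  next
    case weak_bisim_Ret
    then show ?thesis by blast
  next
    case (weak_bisim_Vis F G m n)
    then have "dom G = dom F" "\<forall>e\<in>dom G. weak_bisim (the (F e)) (the (G e))" by auto
    with weak_bisim_Vis(1,2) show ?thesis by blast
  qed
qed

lemma weak_bisim_Sil_right: "weak_bisim P Q \<Longrightarrow> weak_bisim P (Sil Q)"
proof (coinduction arbitrary: P Q)
  case weak_bisim
  then show ?case
  proof (cases rule: weak_bisim.cases)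
    case (weak_bisim_Sil P' Q')
    then show ?thesis by blast
  next
    case (weak_bisim_Ret m x n)
    then have "Sil Q = Sils (Suc n) (Ret x)" by simp
    with weak_bisim_Ret show ?thesis by blast
  next
    case (weak_bisim_Vis F G m n)
    then have "Sil Q = Sils (Suc n) (Vis G)" by simp
    with weak_bisim_Vis show ?thesis by blast
  qed
qed

lemma weak_bisim_SilD:
  assumes "weak_bisim (Sil P) Q"
  shows "weak_bisim P Q"
  using assms
proof (cases rule: weak_bisim.cases)
  case (weak_bisim_Sil Q')
  then show ?thesis by (simp add: weak_bisim_Sil_right)
next
  case (weak_bisim_Ret m x n)
  then show ?thesis by (cases m) (auto intro: weak_bisim.weak_bisim_Ret)
next
  case (weak_bisim_Vis F G m n)
  then show ?thesis by (cases m) (auto intro: weak_bisim.weak_bisim_Vis)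
qed

lemma weak_bisim_SilsD: "weak_bisim (Sils n P) Q \<Longrightarrow> weak_bisim P Q"
  by (induction n) (auto dest: weak_bisim_SilD)

lemma weak_bisim_RetE:
  assumes "weak_bisim (Ret x) Q"
  obtains n where "Q = Sils n (Ret x)"
  using assms
proof (cases rule: weak_bisim.cases)
  case (weak_bisim_Ret m y n)
  then show ?thesis by (auto intro: that)
next
  case (weak_bisim_Vis F G m n)
  then show ?thesis by simp
qed

lemma weak_bisim_VisE:
  assumes "weak_bisim (Vis F) Q"
  obtains n G where "Q = Sils n (Vis G)" "dom F = dom G"
    "\<And>e. e \<in> dom F \<Longrightarrow> weak_bisim (the (F e)) (the (G e))"
  using assms
proof (cases rule: weak_bisim.cases)
  case (weak_bisim_Ret m x n)
  then show ?thesis by simp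
next
  case (weak_bisim_Vis F' G m n)
  then show ?thesis by (intro that[of n G]) simp_all
qed

lemma weak_bisim_stabilises:
  assumes "weak_bisim P Q" "stabilises P"
  shows "stabilises Q"
proof -
  from assms(2) obtain n P' where P': "stable P'" "P = Sils n P'"
    by (auto simp: stabilises_def)
  have "weak_bisim P' Q"
    using assms(1) P'(2) weak_bisim_SilsD by simp
  from P'(1) show ?thesis
  proof (cases rule: stableE)
    case (Ret x)
    with \<open>weak_bisim P' Q\<close> show ?thesis
      by (auto elim!: weak_bisim_RetE)
  next
    case (Vis F)
    with \<open>weak_bisim P' Q\<close> show ?thesis
      by (auto elim!: weak_bisim_VisE)
  qed
qed

lemma weak_bisim_trace_to:
  assumes "trace_to P s P'" "weak_bisim P Q"
  shows "\<exists>Q'. trace_to Q s Q' \<and> weak_bisim P' Q'"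
  using assms
proof (induction arbitrary: Q rule: trace_to.induct)
  case (trace_to_Nil P)
  then show ?case by (blast intro: trace_to.trace_to_Nil)
next
  case (trace_to_Sil P s P')
  then show ?case by (blast dest: weak_bisim_SilD)
next
  case (trace_to_Vis e F s P')
  from trace_to_Vis.prems obtain n G where Q: "Q = Sils n (Vis G)" "dom F = dom G"
    "weak_bisim (the (F e)) (the (G e))"
    using trace_to_Vis.hyps(1) by (metis weak_bisim_VisE)
  from trace_to_Vis.IH[OF Q(3)] obtain Q' where "trace_to (the (G e)) s Q'" "weak_bisim P' Q'"
    by blast
  moreover from this have "trace_to (Vis G) (e # s) Q'"
    using Q(2) trace_to_Vis.hyps(1) by (auto intro: trace_to.trace_to_Vis)
  moreover have "trace_to Q [] (Vis G)"
    using Q(1) by (auto simp: trace_to_Nil_iff)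
  ultimately show ?case using trace_to_append by fastforce
qed

lemma weak_bisim_step_to:
  assumes "weak_bisim P Q" "step_to P s P'"
  shows "\<exists>Q'. step_to Q s Q' \<and> weak_bisim P' Q'"
  using assms(2)
proof (cases rule: step_toE)
  case (Ev t)
  then show ?thesis using weak_bisim_trace_to assms(1) by fastforce
next
  case (Tick t x)
  then obtain Q' where Q': "trace_to Q t Q'" "weak_bisim (Ret x) Q'"
    using weak_bisim_trace_to assms(1) by blast
  have "trace_to Q' [] (Ret x)"
    using Q'(2) by (auto simp: trace_to_Nil_iff elim: weak_bisim_RetE)
  with Q'(1) have "trace_to Q t (Ret x)"
    using trace_to_append by fastforce
  then show ?thesis using Tick by (simp add: weak_bisim_refl)
qed

lemma weak_bisim_traces_subset: "weak_bisim P Q \<Longrightarrow> traces P \<subseteq> traces Q"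
  using weak_bisim_step_to by (fastforce simp: traces_def)

lemma weak_bisim_traces_eq: "weak_bisim P Q \<Longrightarrow> traces P = traces Q"
  by (simp add: subset_antisym weak_bisim_traces_subset weak_bisim_sym)

lemma weak_bisim_failures_subset:
  assumes "weak_bisim P Q"
  shows "failures P \<subseteq> failures Q"
proof -
  have "\<exists>Q'. step_to Q s Q' \<and> stabilises Q'" if "step_to P s P'" "stabilises P'" for s P'
    using weak_bisim_step_to[OF assms that(1)] weak_bisim_stabilises that(2) by blast
  then show ?thesis
    using weak_bisim_traces_eq[OF assms] by (auto simp: failures_iff)
qed

lemma weak_bisim_divergences_subset:
  assumes "weak_bisim P Q"
  shows "divergences P \<subseteq> divergences Q"
proof -
  have "\<exists>Q'. step_to Q s Q' \<and> divergent Q'" if "step_to P s P'" "divergent P'" for s P'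
    using weak_bisim_step_to[OF assms that(1)] weak_bisim_stabilises weak_bisim_sym that(2)
    unfolding divergent_def by blast
  then show ?thesis by (fastforce simp: divergences_def)
qed

theorem theorem14:
  fixes P Q :: "('e, 'r) itree"
  shows
    "(\<forall>s X Y. (s, X) \<in> failures P \<and> Y \<inter> {x. s @ [x] \<in> traces P} = {}
        \<longrightarrow> (s, X \<union> Y) \<in> failures P) \<and>
     (\<forall>s t. s \<in> divergences P \<and> set t \<subseteq> range Ev \<longrightarrow> s @ t \<in> divergences P) \<and>
     (weak_bisim P Q \<longrightarrow> failures P = failures Q \<and> divergences P = divergences Q) \<and>
     (P \<in> divfree \<longleftrightarrow> divergences P = {}) \<and>
     (P \<in> divfree \<longrightarrow> (\<forall>s a. s @ [a] \<in> traces P \<longrightarrow> (s, {a}) \<notin> failures P))"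
proof (intro conjI)
  show "\<forall>s X Y. (s, X) \<in> failures P \<and> Y \<inter> {x. s @ [x] \<in> traces P} = {}
      \<longrightarrow> (s, X \<union> Y) \<in> failures P"
    by (auto simp: failures_iff)
  show "\<forall>s t. s \<in> divergences P \<and> set t \<subseteq> range Ev \<longrightarrow> s @ t \<in> divergences P"
    by (simp add: divergences_append)
  show "weak_bisim P Q \<longrightarrow> failures P = failures Q \<and> divergences P = divergences Q"
    by (simp add: subset_antisym weak_bisim_sym
        weak_bisim_failures_subset weak_bisim_divergences_subset)
  show "P \<in> divfree \<longleftrightarrow> divergences P = {}"
    by (rule divfree_iff_divergences_empty)
  show "P \<in> divfree \<longrightarrow> (\<forall>s a. s @ [a] \<in> traces P \<longrightarrow> (s, {a}) \<notin> failures P)"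
    by (simp add: failures_iff)
qed

end
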